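(* Let $\Delta$ be a type environment of $\mathbf{F}_2^\mu$ and $T$ a type. (1) If $\Delta \vdash T : o$, then $T$ is of the form $\forall x{:}K.T'$ or $T_1 \Rightarrow T_2$. (2) If $\Delta \vdash T : *^n \Rightarrow *$ for some $n\ge 0$, then the $\to_o$-normal form of $T$ is second-order.
   Context: Types of $\mathbf{F}_2^\mu$: $T ::= F \mid x \mid \lambda x.T \mid \forall x{:}K.T \mid T\,T' \mid T \Rightarrow T'$ ($F$ type constants, $x$ type variables). Term kinds $K ::= * \mid * \Rightarrow K$; kinds $k ::= o \mid K$; $*^n\Rightarrow *$ abbreviates $*\Rightarrow\cdots\Rightarrow *\Rightarrow *$ with $n$ arrows. Type environments $\Delta ::= \cdot \mid x:K,\Delta \mid F:K,\Delta$. Kinding $\Delta \vdash T : k$: (i) $\Delta \vdash x : K$ (resp. $F:K$) if $x:K\in\Delta$ (resp. $F:K\in\Delta$); (ii) if $\Delta\vdash T_1 : *$ and $\Delta \vdash T_2 : *\Rightarrow K$ then $\Delta\vdash T_2\,T_1 : K$; (iii) if $\Delta, x:* \vdash T : K$ and $x \in \mathrm{FV}(T)$ then $\Delta \vdash \lambda x.T : * \Rightarrow K$; (iv) if $\Delta, x:K \vdash T : o$ or $\Delta, x:K\vdash T:*$ then $\Delta \vdash \forall x{:}K.T : o$; (v) if each of $T, T'$ has kind $o$ or $*$ then $\Delta \vdash T \Rightarrow T' : o$. $\to_o$ is the compatible closure of $(\lambda x.T)\,T' \to_o [T'/x]T$ (it is strongly normalizing and confluent on well-kinded types, so normal forms are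 unique). A type is flat if it is a variable $x$, a constant $F$, or an application $T_1\,T_2$ with $T_1,T_2$ flat. A type is second-order if it is flat, or of the form $\lambda x_1.\cdots\lambda x_n.T'$ with $T'$ flat and every $x_i \in \mathrm{FV}(T')$. *)

theory Defs
  imports Main
begin

text \<open>\<open>StarTo K\<close> is \<open>* \<Rightarrow> K\<close>: arguments always have kind \<open>*\<close>.  \<open>Prop\<close> is the kind \<open>o\<close>.\<close>

datatype tkind = Star | StarTo tkind

datatype kind = Prop | TKind tkind

text \<open>
  Types are taken up to renaming of bound variables, which is made literal by de Bruijn
  indices: \<open>Lam T\<close> and \<open>Forall K T\<close> bind index 0 in \<open>T\<close>.  The type parameter \<open>'c\<close> is the
  set of type constants.
\<close>

datatype 'c ty =
    Con 'c
  | Var nat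
  | Lam "'c ty"
  | Forall tkind "'c ty"
  | App "'c ty" "'c ty"
  | Arr "'c ty" "'c ty"

primrec FV :: "'c ty \<Rightarrow> nat set" where
  "FV (Con F) = {}"
| "FV (Var i) = {i}"
| "FV (Lam T) = {i. Suc i \<in> FV T}"
| "FV (Forall K T) = {i. Suc i \<in> FV T}"
| "FV (App T T') = FV T \<union> FV T'"
| "FV (Arr T T') = FV T \<union> FV T'"

primrec lift :: "'c ty \<Rightarrow> nat \<Rightarrow> 'c ty" where
  "lift (Con F) k = Con F"
| "lift (Var i) k = (if i < k then Var i else Var (Suc i))"
| "lift (Lam T) k = Lam (lift T (Suc k))"
| "lift (Forall K T) k = Forall K (lift T (Suc k))"
| "lift (App T T') k = App (lift T k) (lift T' k)"
| "lift (Arr T T') k = Arr (lift T k) (lift T' k)"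

text \<open>
  \<open>subst T S k\<close> replaces index \<open>k\<close> in \<open>T\<close> by \<open>S\<close> and removes the binder of \<open>k\<close>, so the
  indices above \<open>k\<close> are decremented.
\<close>

primrec subst :: "'c ty \<Rightarrow> 'c ty \<Rightarrow> nat \<Rightarrow> 'c ty" where
  "subst (Con F) S k = Con F"
| "subst (Var i) S k = (if k < i then Var (i - 1) else if i = k then S else Var i)"
| "subst (Lam T) S k = Lam (subst T (lift S 0) (Suc k))"
| "subst (Forall K T) S k = Forall K (subst T (lift S 0) (Suc k))"
| "subst (App T T') S k = App (subst T S k) (subst T' S k)"
| "subst (Arr T T') S k = Arr (subst T S k) (subst T' S k)"

text \<open>
  A type environment is split into its constant declarations \<open>C\<close> and its variable
  declarations \<open>D\<close>; \<open>D ! i\<close> is the kind of the variable with index \<open>i\<close>, and adding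
  \<open>x : K\<close> conses \<open>K\<close> onto \<open>D\<close>.  The relative order of constant and variable
  declarations plays no role in kinding.
\<close>

inductive kinding :: "('c \<times> tkind) list \<Rightarrow> tkind list \<Rightarrow> 'c ty \<Rightarrow> kind \<Rightarrow> bool"
  for C :: "('c \<times> tkind) list" where
  kind_Var: "i < length D \<Longrightarrow> D ! i = K \<Longrightarrow> kinding C D (Var i) (TKind K)"
| kind_Con: "(F, K) \<in> set C \<Longrightarrow> kinding C D (Con F) (TKind K)"
| kind_App: "kinding C D T1 (TKind Star) \<Longrightarrow> kinding C D T2 (TKind (StarTo K)) \<Longrightarrow>
    kinding C D (App T2 T1) (TKind K)"
| kind_Lam: "kinding C (Star # D) T (TKind K) \<Longrightarrow> 0 \<in> FV T \<Longrightarrow>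
    kinding C D (Lam T) (TKind (StarTo K))"
| kind_All: "kinding C (K # D) T k \<Longrightarrow> k \<in> {Prop, TKind Star} \<Longrightarrow>
    kinding C D (Forall K T) Prop"
| kind_Arr: "kinding C D T k \<Longrightarrow> k \<in> {Prop, TKind Star} \<Longrightarrow>
    kinding C D T' k' \<Longrightarrow> k' \<in> {Prop, TKind Star} \<Longrightarrow>
    kinding C D (Arr T T') Prop"

inductive red :: "'c ty \<Rightarrow> 'c ty \<Rightarrow> bool"  (infix \<open>\<rightarrow>\<^sub>o\<close> 50) where
  red_beta: "App (Lam T) T' \<rightarrow>\<^sub>o subst T T' 0"
| red_Lam: "T \<rightarrow>\<^sub>o U \<Longrightarrow> Lam T \<rightarrow>\<^sub>o Lam U"
| red_All: "T \<rightarrow>\<^sub>o U \<Longrightarrow> Forall K T \<rightarrow>\<^sub>o Forall K U"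
| red_AppL: "T \<rightarrow>\<^sub>o U \<Longrightarrow> App T T' \<rightarrow>\<^sub>o App U T'"
| red_AppR: "T \<rightarrow>\<^sub>o U \<Longrightarrow> App T' T \<rightarrow>\<^sub>o App T' U"
| red_ArrL: "T \<rightarrow>\<^sub>o U \<Longrightarrow> Arr T T' \<rightarrow>\<^sub>o Arr U T'"
| red_ArrR: "T \<rightarrow>\<^sub>o U \<Longrightarrow> Arr T' T \<rightarrow>\<^sub>o Arr T' U"

definition is_normal_form_of :: "'c ty \<Rightarrow> 'c ty \<Rightarrow> bool" where
  "is_normal_form_of N T \<longleftrightarrow> red\<^sup>*\<^sup>* T N \<and> \<not> (\<exists>U. N \<rightarrow>\<^sub>o U)"

inductive flat :: "'c ty \<Rightarrow> bool" where
  flat_Var: "flat (Var i)"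
| flat_Con: "flat (Con F)"
| flat_App: "flat T1 \<Longrightarrow> flat T2 \<Longrightarrow> flat (App T1 T2)"

text \<open>In the body of \<open>n\<close> nested abstractions the bound variables are the indices below \<open>n\<close>.\<close>

definition second_order :: "'c ty \<Rightarrow> bool" where
  "second_order T \<longleftrightarrow> flat T \<or>
    (\<exists>n T'. T = (Lam ^^ n) T' \<and> flat T' \<and> (\<forall>i<n. i \<in> FV T'))"

end

theory Submission
  imports Defs
begin

text \<open>
  Arguments have kind \<open>*\<close>, and a type of kind \<open>*\<close> never normalizes to an abstraction, so
  substituting an argument into a normal type creates no redex.  Hence a normalizer \<open>nf\<close> is
  definable by structural recursion: normalize both parts of an application and contract at most
  the head redex.  Every type reduces to its \<open>nf\<close>, and on well-kinded types \<open>nf\<close> is invariant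
  under reduction; so a normal form \<open>N\<close> of \<open>T\<close> satisfies \<open>N = nf N = nf T\<close>, which gives
  uniqueness without a confluence argument.
\<close>

section \<open>Free variables and commutation laws for lifting and substitution\<close>

lemma mem_FV_lift:
  "i \<in> FV (lift T k) \<longleftrightarrow> (i < k \<and> i \<in> FV T) \<or> (\<exists>j\<ge>k. i = Suc j \<and> j \<in> FV T)"
proof (induction T arbitrary: i k)
  case (Lam T)
  then show ?case by (cases i) auto
next
  case (Forall K T)
  then show ?case by (cases i) auto
qed auto

lemma mem_FV_subst:
  "i \<in> FV (subst T S k) \<longleftrightarrow>
    (i < k \<and> i \<in> FV T) \<or> (k \<le> i \<and> Suc i \<in> FV T) \<or> (k \<in> FV T \<and> i \<in> FV S)"
  by (induction T arbitrary: i k S) (auto simp: mem_FV_lift)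

lemma lift_lift: "i \<le> k \<Longrightarrow> lift (lift T i) (Suc k) = lift (lift T k) i"
  by (induction T arbitrary: i k) auto

lemma lift_subst_ge: "j \<le> k \<Longrightarrow> lift (subst T S j) k = subst (lift T (Suc k)) (lift S k) j"
  by (induction T arbitrary: j k S) (auto simp: lift_lift)

lemma lift_subst_le: "i \<le> k \<Longrightarrow> lift (subst T S k) i = subst (lift T i) (lift S i) (Suc k)"
  by (induction T arbitrary: i k S) (auto simp: lift_lift)

lemma subst_lift: "subst (lift T k) S k = T"
  by (induction T arbitrary: k S) auto

text \<open>The usual substitution lemma with de Bruijn indices. When \<open>U\<close> is
  substituted first, the binder of \<open>j\<close> is still present, so \<open>k\<close> becomes
  \<open>Suc k\<close> and \<open>U\<close> is lifted past \<open>j\<close>.\<close>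

lemma subst_subst:
  "j \<le> k \<Longrightarrow>
    subst (subst T S j) U k = subst (subst T (lift U j) (Suc k)) (subst S U k) j"
  by (induction T arbitrary: j k S U) (auto simp: lift_lift lift_subst_le subst_lift)

section \<open>Weakening, substitution and subject reduction for kinding\<close>

lemma kinding_lift:
  "kinding C D T k \<Longrightarrow> D = D1 @ D2 \<Longrightarrow> kinding C (D1 @ K # D2) (lift T (length D1)) k"
proof (induction arbitrary: D1 rule: kinding.induct)
  case (kind_Var i D K')
  then show ?case by (auto intro!: kinding.kind_Var simp: nth_append Suc_diff_le)
next
  case (kind_Lam D T K')
  from kind_Lam.IH[of "Star # D1"] kind_Lam.prems kind_Lam.hyps show ?case
    by (auto intro!: kinding.kind_Lam simp: mem_FV_lift)
next
  case (kind_All K' D T k)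
  from kind_All.IH[of "K' # D1"] kind_All.prems kind_All.hyps show ?case
    by (auto intro: kinding.kind_All)
next
  case (kind_Arr D T k T' k')
  from kind_Arr.IH kind_Arr.prems kind_Arr.hyps show ?case
    by (simp only: lift.simps) (blast intro: kinding.kind_Arr)
qed (auto intro: kinding.intros)

lemma kinding_subst:
  "kinding C D T k \<Longrightarrow> D = D1 @ K # D2 \<Longrightarrow> kinding C (D1 @ D2) S (TKind K) \<Longrightarrow>
    kinding C (D1 @ D2) (subst T S (length D1)) k"
proof (induction arbitrary: D1 S rule: kinding.induct)
  case (kind_Var i D K')
  then show ?case by (auto intro!: kinding.kind_Var simp: nth_append not_less nth_Cons')
next
  case (kind_Lam D T K')
  have "kinding C (Star # D1 @ D2) (lift S 0) (TKind K)"
    using kinding_lift[OF kind_Lam.prems(2), of "[]"] by simp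
  with kind_Lam.IH[of "Star # D1"] kind_Lam.prems kind_Lam.hyps show ?case
    by (auto intro!: kinding.kind_Lam simp: mem_FV_subst)
next
  case (kind_All K' D T k)
  have "kinding C (K' # D1 @ D2) (lift S 0) (TKind K)"
    using kinding_lift[OF kind_All.prems(2), of "[]"] by simp
  with kind_All.IH[of "K' # D1"] kind_All.prems kind_All.hyps show ?case
    by (auto intro: kinding.kind_All)
next
  case (kind_Arr D T k T' k')
  from kind_Arr.IH kind_Arr.prems kind_Arr.hyps show ?case
    by (simp only: subst.simps) (blast intro: kinding.kind_Arr)
qed (auto intro: kinding.intros)

inductive_cases kinding_AppE: "kinding C D (App T U) k"
inductive_cases kinding_LamE: "kinding C D (Lam T) k"
inductive_cases kinding_AllE: "kinding C D (Forall K T) k"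
inductive_cases kinding_ArrE: "kinding C D (Arr T U) k"

text \<open>A kinded abstraction uses its bound variable, so contraction never discards the
  argument. This preserves the occurrence condition of \<open>kind_Lam\<close> in
  \<open>kinding_red\<close>.\<close>

lemma FV_red: "T \<rightarrow>\<^sub>o U \<Longrightarrow> kinding C D T k \<Longrightarrow> FV U = FV T"
proof (induction arbitrary: D k rule: red.induct)
  case (red_beta T T')
  then have "0 \<in> FV T" by (auto elim!: kinding_AppE kinding_LamE)
  then show ?case by (auto simp: mem_FV_subst)
next
  case (red_Lam T U)
  then show ?case by (fastforce elim: kinding_LamE)
next
  case (red_All T U K)
  then show ?case by (fastforce elim: kinding_AllE)
next
  case (red_AppL T U T')
  then show ?case by (fastforce elim: kinding_AppE)
next
  case (red_AppR T U T')
  then show ?case by (fastforce elim: kinding_AppE)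
next
  case (red_ArrL T U T')
  then show ?case by (fastforce elim: kinding_ArrE)
next
  case (red_ArrR T U T')
  then show ?case by (fastforce elim: kinding_ArrE)
qed

lemma kinding_red: "T \<rightarrow>\<^sub>o U \<Longrightarrow> kinding C D T k \<Longrightarrow> kinding C D U k"
proof (induction arbitrary: D k rule: red.induct)
  case (red_beta T T')
  then show ?case
    using kinding_subst[where ?D1.0 = "[]"] by (fastforce elim!: kinding_AppE kinding_LamE)
next
  case (red_Lam T U)
  then show ?case by (auto elim!: kinding_LamE intro!: kind_Lam simp: FV_red)
qed (blast elim: kinding_AllE kinding_AppE kinding_ArrE intro: kinding.intros)+

lemma kinding_rtranclp_red: "red\<^sup>*\<^sup>* T U \<Longrightarrow> kinding C D T k \<Longrightarrow> kinding C D U k"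
  by (induction rule: rtranclp_induct) (auto intro: kinding_red)

section \<open>The structural normalizer and its invariance under reduction\<close>

fun napp :: "'c ty \<Rightarrow> 'c ty \<Rightarrow> 'c ty" where
  "napp (Lam T) U = subst T U 0"
| "napp T U = App T U"

primrec nf :: "'c ty \<Rightarrow> 'c ty" where
  "nf (Con F) = Con F"
| "nf (Var i) = Var i"
| "nf (Lam T) = Lam (nf T)"
| "nf (Forall K T) = Forall K (nf T)"
| "nf (App T U) = napp (nf T) (nf U)"
| "nf (Arr T U) = Arr (nf T) (nf U)"

lemma rtranclp_red_cong:
  assumes "\<And>T U. T \<rightarrow>\<^sub>o U \<Longrightarrow> f T \<rightarrow>\<^sub>o f U" and "red\<^sup>*\<^sup>* T U"
  shows "red\<^sup>*\<^sup>* (f T) (f U)"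
  using assms(2) by (induction rule: rtranclp_induct)
    (auto intro: assms(1) rtranclp.rtrancl_into_rtrancl)

lemma App_red_napp: "red\<^sup>*\<^sup>* (App T U) (napp T U)"
  by (cases T) (auto intro: red_beta)

lemma red_nf: "red\<^sup>*\<^sup>* T (nf T)"
proof (induction T)
  case (Lam T)
  then show ?case using rtranclp_red_cong[of Lam] red_Lam by (metis nf.simps(3))
next
  case (Forall K T)
  then show ?case using rtranclp_red_cong[of "Forall K"] red_All by (metis nf.simps(4))
next
  case (App T U)
  have "red\<^sup>*\<^sup>* (App T U) (App (nf T) U)"
    using rtranclp_red_cong[of "\<lambda>X. App X U"] red_AppL App.IH(1) by blast
  also have "red\<^sup>*\<^sup>* (App (nf T) U) (App (nf T) (nf U))"
    using rtranclp_red_cong[of "App (nf T)"] red_AppR App.IH(2) by blast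
  also have "red\<^sup>*\<^sup>* (App (nf T) (nf U)) (napp (nf T) (nf U))"
    by (rule App_red_napp)
  finally show ?case by simp
next
  case (Arr T U)
  have "red\<^sup>*\<^sup>* (Arr T U) (Arr (nf T) U)"
    using rtranclp_red_cong[of "\<lambda>X. Arr X U"] red_ArrL Arr.IH(1) by blast
  also have "red\<^sup>*\<^sup>* (Arr (nf T) U) (Arr (nf T) (nf U))"
    using rtranclp_red_cong[of "Arr (nf T)"] red_ArrR Arr.IH(2) by blast
  finally show ?case by simp
qed auto

lemma kinding_nf: "kinding C D T k \<Longrightarrow> kinding C D (nf T) k"
  using kinding_rtranclp_red red_nf by blast

text \<open>Normalization preserves kinds, and \<open>kind_Lam\<close> gives abstractions only kinds
  of the form \<open>StarTo K\<close>.\<close>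

lemma nf_Star_neq_Lam: "kinding C D T (TKind Star) \<Longrightarrow> nf T \<noteq> Lam B"
  by (metis kinding_nf kinding_LamE kind.inject tkind.distinct(1))

lemma lift_napp: "lift (napp T U) k = napp (lift T k) (lift U k)"
  by (cases T) (auto simp: lift_subst_ge)

lemma nf_lift: "nf (lift T k) = lift (nf T) k"
  by (induction T arbitrary: k) (auto simp: lift_napp)

text \<open>The assumption excludes the one case where substitution creates a head redex: on the
  left it would stay uncontracted, on the right \<open>napp\<close> would contract it.\<close>

lemma subst_napp:
  assumes "T \<noteq> Var k \<or> (\<forall>B. S \<noteq> Lam B)"
  shows "subst (napp T U) S k = napp (subst T S k) (subst U S k)"
proof (cases T)
  case (Var i)
  with assms show ?thesis by (cases S) auto
next
  case (Lam B)
  then show ?thesis by (simp add: subst_subst[of 0])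
qed auto

lemma lift_neq_Lam: "\<forall>B. T \<noteq> Lam B \<Longrightarrow> lift T k \<noteq> Lam B"
  by (cases T) auto

text \<open>The hypothesis on \<open>S\<close> survives passing under binders, since lifting
  commutes with \<open>nf\<close> and creates no abstraction; at applications it is what
  \<open>subst_napp\<close> requires.\<close>

lemma nf_subst:
  "\<forall>B. nf S \<noteq> Lam B \<Longrightarrow> nf (subst T S k) = subst (nf T) (nf S) k"
  by (induction T arbitrary: S k) (auto simp: nf_lift subst_napp lift_neq_Lam)

lemma nf_red: "T \<rightarrow>\<^sub>o U \<Longrightarrow> kinding C D T k \<Longrightarrow> nf U = nf T"
proof (induction arbitrary: D k rule: red.induct)
  case (red_beta T T')
  \<comment> \<open>An argument of kind \<open>*\<close> does not normalize to an abstraction, so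
    \<open>nf_subst\<close> applies to the contractum.\<close>
  then have "kinding C D T' (TKind Star)" by (auto elim: kinding_AppE)
  then show ?case by (simp add: nf_subst nf_Star_neq_Lam)
qed (auto elim!: kinding_LamE kinding_AllE kinding_AppE kinding_ArrE)

lemma nf_rtranclp_red: "red\<^sup>*\<^sup>* T U \<Longrightarrow> kinding C D T k \<Longrightarrow> nf U = nf T"
  by (induction rule: rtranclp_induct) (auto dest: kinding_rtranclp_red nf_red)

lemma nf_eq_self: "\<nexists>U. N \<rightarrow>\<^sub>o U \<Longrightarrow> nf N = N"
  using red_nf[of N] by (auto elim: converse_rtranclpE)

section \<open>Flat and second-order types\<close>

lemma flat_lift: "flat T \<Longrightarrow> flat (lift T k)"
  by (induction rule: flat.induct) (auto intro: flat.intros)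

lemma flat_subst: "flat T \<Longrightarrow> flat S \<Longrightarrow> flat (subst T S k)"
  by (induction rule: flat.induct) (auto intro: flat.intros)

lemma flat_neq_Lam: "flat T \<Longrightarrow> T \<noteq> Lam B"
  by (auto elim: flat.cases)

lemma flat_normal: "flat T \<Longrightarrow> \<not> T \<rightarrow>\<^sub>o U"
  by (induction arbitrary: U rule: flat.induct) (auto elim: red.cases dest: flat_neq_Lam)

lemma second_order_flat: "flat T \<Longrightarrow> second_order T"
  by (simp add: second_order_def)

lemma mem_FV_funpow_Lam: "i \<in> FV ((Lam ^^ n) T) \<longleftrightarrow> i + n \<in> FV T"
  by (induction n arbitrary: i) auto

text \<open>Replaces the iterated abstraction of the definition by a condition on one binder at a
  time, which suits induction.\<close>

lemma second_order_Lam: "second_order (Lam T) \<longleftrightarrow> second_order T \<and> 0 \<in> FV T"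
proof
  assume "second_order (Lam T)"
  then obtain n B where B: "Lam T = (Lam ^^ n) B" "flat B" "\<forall>i<n. i \<in> FV B"
    by (auto simp: second_order_def dest: flat_neq_Lam)
  \<comment> \<open>\<open>n = 0\<close> would make the flat \<open>B\<close> an
    abstraction.\<close>
  then obtain m where "n = Suc m" by (cases n) (auto dest: flat_neq_Lam)
  with B show "second_order T \<and> 0 \<in> FV T"
    unfolding second_order_def
    by (intro conjI disjI2 exI[of _ m] exI[of _ B]) (auto simp: mem_FV_funpow_Lam)
next
  assume T: "second_order T \<and> 0 \<in> FV T"
  \<comment> \<open>A flat \<open>T\<close> is covered by \<open>n = 0\<close>.\<close>
  then obtain n B where "T = (Lam ^^ n) B" "flat B" "\<forall>i<n. i \<in> FV B"
    unfolding second_order_def by (metis funpow_0 less_zeroE)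
  \<comment> \<open>Index 0 of \<open>T\<close> is index \<open>n\<close> below its \<open>n\<close>
    abstractions; this is the extra condition needed for \<open>Suc n\<close> binders.\<close>
  moreover from this T have "n \<in> FV B" by (simp add: mem_FV_funpow_Lam)
  ultimately show "second_order (Lam T)"
    unfolding second_order_def by (intro disjI2 exI[of _ "Suc n"] exI[of _ B]) (auto simp: less_Suc_eq)
qed

lemma second_order_induct [consumes 1, case_names flat Lam]:
  assumes "second_order T"
    and flat: "\<And>T. flat T \<Longrightarrow> P T"
    and Lam: "\<And>T. second_order T \<Longrightarrow> 0 \<in> FV T \<Longrightarrow> P T \<Longrightarrow> P (Lam T)"
  shows "P T"
  using assms(1)
proof (induction T)
  case (Lam T)
  then show ?case by (auto simp: second_order_Lam intro: assms(3))
next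
  case (Forall K T)
  \<comment> \<open>Only \<open>n = 0\<close> is possible, so the type itself is flat; the next two
    cases argue likewise.\<close>
  have "(Lam ^^ n) B = Forall K T \<Longrightarrow> B = Forall K T" for n B by (cases n) auto
  with Forall show ?case unfolding second_order_def by (metis flat)
next
  case (App T U)
  have "(Lam ^^ n) B = App T U \<Longrightarrow> B = App T U" for n B by (cases n) auto
  with App show ?case unfolding second_order_def by (metis flat)
next
  case (Arr T U)
  have "(Lam ^^ n) B = Arr T U \<Longrightarrow> B = Arr T U" for n B by (cases n) auto
  with Arr show ?case unfolding second_order_def by (metis flat)
qed (auto intro: assms(2) flat.intros)

lemma second_order_normal: "second_order T \<Longrightarrow> \<not> T \<rightarrow>\<^sub>o U"
proof (induction arbitrary: U rule: second_order_induct)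
  case (Lam T)
  then show ?case by (auto elim: red.cases)
qed (auto dest: flat_normal)

lemma second_order_subst: "second_order T \<Longrightarrow> flat S \<Longrightarrow> second_order (subst T S k)"
  by (induction arbitrary: S k rule: second_order_induct)
    (auto simp: second_order_Lam mem_FV_subst flat_lift intro: second_order_flat flat_subst)

lemma second_order_cases:
  assumes "second_order T"
  obtains "flat T" | B where "T = Lam B" "second_order B"
  using assms by (induction rule: second_order_induct) auto

lemma second_order_napp:
  assumes "second_order T" and "flat U"
  shows "second_order (napp T U)"
  using assms(1)
proof (cases rule: second_order_cases)
  case 1
  with assms(2) have "napp T U = App T U" "flat (App T U)"
    by (auto elim: flat.cases intro: flat_App)
  then show ?thesis by (simp add: second_order_flat)
next
  case (2 B)
  with assms(2) show ?thesis by (simp add: second_order_subst)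
qed

text \<open>At an application the argument has kind \<open>*\<close>, so its second-order normal
  form is no abstraction and hence flat; contracting with a flat argument stays
  second-order.\<close>

lemma second_order_nf: "kinding C D T k \<Longrightarrow> k = TKind K \<Longrightarrow> second_order (nf T)"
proof (induction arbitrary: K rule: kinding.induct)
  case (kind_App D T1 T2 K')
  have "flat (nf T1)"
    using kind_App.IH(1) nf_Star_neq_Lam[OF kind_App.hyps(1)] by (auto elim: second_order_cases)
  with kind_App.IH(2) show ?case by (simp add: second_order_napp)
next
  case (kind_Lam D T K')
  \<comment> \<open>Kind preservation is applied to the whole abstraction, and the occurrence
    condition is read off the kinding of \<open>Lam (nf T)\<close>.\<close>
  have "0 \<in> FV (nf T)"
    using kinding_nf[OF kinding.kind_Lam[OF kind_Lam.hyps]] by (auto elim: kinding_LamE)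
  with kind_Lam.IH show ?case by (simp add: second_order_Lam)
qed (auto intro: second_order_flat flat.intros)

lemma is_normal_form_of_iff:
  assumes "kinding C D T (TKind K)"
  shows "is_normal_form_of N T \<longleftrightarrow> N = nf T"
proof
  assume "is_normal_form_of N T"
  then have "red\<^sup>*\<^sup>* T N" "nf N = N"
    by (auto simp: is_normal_form_of_def nf_eq_self)
  with assms show "N = nf T" by (metis nf_rtranclp_red)
next
  assume "N = nf T"
  \<comment> \<open>Irreducibility of \<open>nf T\<close> follows from its second-order
    shape.\<close>
  with assms show "is_normal_form_of N T"
    by (auto simp: is_normal_form_of_def red_nf dest: second_order_nf second_order_normal)
qed

theorem theorem9:
  fixes C :: "('c \<times> tkind) list" and D :: "tkind list" and T :: "'c ty"
  shows "(kinding C D T Prop \<longrightarrow>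
            (\<exists>K T'. T = Forall K T') \<or> (\<exists>T1 T2. T = Arr T1 T2)) \<and>
         (\<forall>n. kinding C D T (TKind ((StarTo ^^ n) Star)) \<longrightarrow>
            (\<exists>!N. is_normal_form_of N T) \<and>
            (\<forall>N. is_normal_form_of N T \<longrightarrow> second_order N))"
proof (intro conjI allI impI)
  assume "kinding C D T Prop"
  then show "(\<exists>K T'. T = Forall K T') \<or> (\<exists>T1 T2. T = Arr T1 T2)"
    by (cases rule: kinding.cases) auto
\<comment> \<open>Being a normal form of \<open>T\<close> becomes the equation
  \<open>N = nf T\<close>, which settles existence, uniqueness and shape together.\<close>
qed (auto simp: is_normal_form_of_iff second_order_nf)

end
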